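(* Let $E, A \in \mathbb{C}^{n \times n}$, $B \in \mathbb{C}^{n \times m}$, $C \in \mathbb{C}^{p \times n}$ be a realization of the transfer function $G(s) = C(sE - A)^{-1}B$. Suppose there exist matrices $T, W \in \mathbb{C}^{n \times n}$ (a generalized state-space transformation) such that $$\widetilde{E} = W^{\mathsf H} E T, \quad \widetilde{A} = W^{\mathsf H} A T, \quad \widetilde{B} = W^{\mathsf H} B, \quad \widetilde{C} = C T$$ is state-space Hermitian and dissipative, i.e., $$\widetilde{E} = \widetilde{E}^{\mathsf H} > 0, \qquad \widetilde{A} = \widetilde{A}^{\mathsf H} < 0, \qquad \widetilde{B} = \widetilde{C}^{\mathsf H}$$ (in particular $p = m$). Then for any $N \geq 1$ and any real nodes $\omega_1, \ldots, \omega_N$ and real weights $\xi_1, \ldots, \xi_N$ such that $\mathrm{i}\omega_i E - A$ and $-\mathrm{i}\omega_i E - A$ are invertible for all $i$, the Hermite data matrices $\mathbb{E}_L, \mathbb{A}_L, \mathbb{B}_L, \mathbb{C}_L$ constructed from $G$, $G'$ and $\{(\omega_i, \xi_i)\}_{i=1}^N$ (as defined in the context) satisfy $$\mathbb{E}_L = \mathbb{E}_L^{\mathsf H} \geq 0, \qquad \mathbb{A}_L = \mathbb{A}_L^{\mathsf H} \leq 0, \qquad \mathbb{B}_L = \mathbb{C}_L^{\mathsf H}.$$ Moreover, for any reduction order $r$ for which $\check{\Sigma}_1$ is invertible, the reduced-order matrices $\widehat{E}, \widehat{A}, \widehat{B}, \widehat{C}$ produced by symmetric Hermite quadrature-based balanced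 truncation (as defined in the context) are state-space Hermitian and dissipative, i.e., $\widehat{E} = \widehat{E}^{\mathsf H} > 0$, $\widehat{A} = \widehat{A}^{\mathsf H} < 0$, and $\widehat{B} = \widehat{C}^{\mathsf H}$.
   Context: $\mathrm{i}$ is the imaginary unit, $M^{\mathsf H}$ is the conjugate transpose, and for Hermitian matrices $>0$, $<0$, $\geq 0$, $\leq 0$ mean positive definite, negative definite, positive semi-definite, negative semi-definite. Hermite data matrices. Let $G'(s) = \frac{d}{ds}G(s)$. The nodes/weights $\{(\omega_i,\xi_i)\}_{i=1}^N$ encode a symmetric pair of quadrature rules: the right rule has nodes $\omega_i$ and weights $\xi_i$, the left rule has nodes $-\omega_i$ and the same weights $\xi_i$. The matrices $\mathbb{E}_L, \mathbb{A}_L \in \mathbb{C}^{pN \times mN}$, $\mathbb{B}_L \in \mathbb{C}^{pN \times m}$, $\mathbb{C}_L \in \mathbb{C}^{p \times mN}$ are defined through their $p \times m$ blocks, for $k, j = 1, \ldots, N$ ($k$ the block-row index, $j$ the block-column index): $$(\mathbb{E}_L)_{k,j} = \begin{cases} -\xi_k \xi_j\, G'(\mathrm{i}\omega_j) & \text{if } \omega_j = -\omega_k, \\[4pt] -\xi_k \xi_j\, \dfrac{G(-\mathrm{i}\omega_k) - G(\mathrm{i}\omega_j)}{-\mathrm{i}\omega_k - \mathrm{i}\omega_j} & \text{if } \omega_j \neq -\omega_k, \end{cases}$$ $$(\mathbb{A}_L)_{k,j} = \begin{cases} -\xi_k \xi_j \big( G(\mathrm{i}\omega_j) + \mathrm{i}\omega_j\,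 G'(\mathrm{i}\omega_j) \big) & \text{if } \omega_j = -\omega_k, \\[4pt] -\xi_k \xi_j\, \dfrac{-\mathrm{i}\omega_k G(-\mathrm{i}\omega_k) - \mathrm{i}\omega_j G(\mathrm{i}\omega_j)}{-\mathrm{i}\omega_k - \mathrm{i}\omega_j} & \text{if } \omega_j \neq -\omega_k, \end{cases}$$ $$(\mathbb{B}_L)_{k} = \xi_k\, G(-\mathrm{i}\omega_k), \qquad (\mathbb{C}_L)_{j} = \xi_j\, G(\mathrm{i}\omega_j).$$ Symmetric Hermite quadrature-based balanced truncation. Given the data matrices and a reduction order $r$, take a singular value decomposition $$\mathbb{E}_L = \begin{bmatrix} \check{U}_1 & \check{U}_2 \end{bmatrix} \begin{bmatrix} \check{\Sigma}_1 & 0 \\ 0 & \check{\Sigma}_2 \end{bmatrix} \begin{bmatrix} \check{V}_1^{\mathsf H} \\ \check{V}_2^{\mathsf H} \end{bmatrix},$$ where $\check{\Sigma}_1 \in \mathbb{R}^{r \times r}$ is diagonal and contains the $r$ largest singular values and the other blocks are partitioned accordingly. When $\check{\Sigma}_1$ is invertible, the output is $$\widehat{E} = I_r, \quad \widehat{A} = \check{\Sigma}_1^{-1/2} \check{U}_1^{\mathsf H} \mathbb{A}_L \check{V}_1 \check{\Sigma}_1^{-1/2}, \quad \widehat{B} = \check{\Sigma}_1^{-1/2} \check{U}_1^{\mathsf H} \mathbb{B}_L, \quad \widehat{C} = \mathbb{C}_L \check{V}_1 \check{\Sigma}_1^{-1/2}.$$ *)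

theory Defs
  imports
    "HOL-Analysis.Derivative"
    "Jordan_Normal_Form.Schur_Decomposition"
    "Jordan_Normal_Form.Gauss_Jordan_Elimination"
begin

section \<open>Definiteness of Hermitian matrices\<close>

text \<open>
  The form \<open>v\<^sup>H A v\<close> is written \<open>(A *\<^sub>v v) \<bullet>c v\<close>, since \<open>\<bullet>c\<close> conjugates its second argument.
  Comparisons with \<open>0\<close> use the partial order on the complex numbers, in which
  \<open>0 < z\<close> means that \<open>z\<close> is real and positive.
\<close>

definition hermitian_mat :: "complex mat \<Rightarrow> bool" where
  "hermitian_mat A \<longleftrightarrow> mat_adjoint A = A"

definition pos_def_mat :: "complex mat \<Rightarrow> bool" where
  "pos_def_mat A \<longleftrightarrow> hermitian_mat A \<and>
     (\<forall>v \<in> carrier_vec (dim_row A). v \<noteq> 0\<^sub>v (dim_row A) \<longrightarrow> 0 < (A *\<^sub>v v) \<bullet>c v)"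

definition neg_def_mat :: "complex mat \<Rightarrow> bool" where
  "neg_def_mat A \<longleftrightarrow> hermitian_mat A \<and>
     (\<forall>v \<in> carrier_vec (dim_row A). v \<noteq> 0\<^sub>v (dim_row A) \<longrightarrow> (A *\<^sub>v v) \<bullet>c v < 0)"

definition pos_semidef_mat :: "complex mat \<Rightarrow> bool" where
  "pos_semidef_mat A \<longleftrightarrow> hermitian_mat A \<and>
     (\<forall>v \<in> carrier_vec (dim_row A). 0 \<le> (A *\<^sub>v v) \<bullet>c v)"

definition neg_semidef_mat :: "complex mat \<Rightarrow> bool" where
  "neg_semidef_mat A \<longleftrightarrow> hermitian_mat A \<and>
     (\<forall>v \<in> carrier_vec (dim_row A). (A *\<^sub>v v) \<bullet>c v \<le> 0)"

text \<open>
  Equality in \<^typ>\<open>complex mat\<close> includes equality of dimensions, so \<open>B = mat_adjoint C\<close> forces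
  the numbers of inputs and outputs to agree.
\<close>

definition hermitian_dissipative ::
    "complex mat \<Rightarrow> complex mat \<Rightarrow> complex mat \<Rightarrow> complex mat \<Rightarrow> bool" where
  "hermitian_dissipative E A B C \<longleftrightarrow>
     pos_def_mat E \<and> neg_def_mat A \<and> B = mat_adjoint C"


section \<open>Transfer functions and their derivatives\<close>

text \<open>The value is meaningful only where \<open>s E - A\<close> is invertible.\<close>

definition transfer_function ::
    "complex mat \<Rightarrow> complex mat \<Rightarrow> complex mat \<Rightarrow> complex mat \<Rightarrow> complex \<Rightarrow> complex mat" where
  "transfer_function E A B C s = C * the (mat_inverse (s \<cdot>\<^sub>m E - A)) * B"

definition mat_deriv :: "(complex \<Rightarrow> complex mat) \<Rightarrow> complex \<Rightarrow> complex mat" where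
  "mat_deriv G s = mat (dim_row (G s)) (dim_col (G s)) (\<lambda>(i, j). deriv (\<lambda>z. G z $$ (i, j)) s)"


section \<open>Hermite data matrices\<close>

text \<open>The \<open>K \<times> J\<close> block matrix whose \<open>(k, j)\<close> block, of size \<open>p \<times> m\<close>, is \<open>F k j\<close> (indices from 0).\<close>

definition block_matrix ::
    "nat \<Rightarrow> nat \<Rightarrow> nat \<Rightarrow> nat \<Rightarrow> (nat \<Rightarrow> nat \<Rightarrow> complex mat) \<Rightarrow> complex mat" where
  "block_matrix p m K J F =
     mat (p * K) (m * J) (\<lambda>(a, b). F (a div p) (b div m) $$ (a mod p, b mod m))"

definition hermite_E ::
    "nat \<Rightarrow> nat \<Rightarrow> nat \<Rightarrow> (complex \<Rightarrow> complex mat) \<Rightarrow> (nat \<Rightarrow> real) \<Rightarrow> (nat \<Rightarrow> real) \<Rightarrow> complex mat" where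
  "hermite_E p m N G \<omega> \<xi> = block_matrix p m N N (\<lambda>k j.
     complex_of_real (- \<xi> k * \<xi> j) \<cdot>\<^sub>m
       (if \<omega> j = - \<omega> k then mat_deriv G (\<i> * \<omega> j)
        else (1 / (- \<i> * \<omega> k - \<i> * \<omega> j)) \<cdot>\<^sub>m (G (- \<i> * \<omega> k) - G (\<i> * \<omega> j))))"

definition hermite_A ::
    "nat \<Rightarrow> nat \<Rightarrow> nat \<Rightarrow> (complex \<Rightarrow> complex mat) \<Rightarrow> (nat \<Rightarrow> real) \<Rightarrow> (nat \<Rightarrow> real) \<Rightarrow> complex mat" where
  "hermite_A p m N G \<omega> \<xi> = block_matrix p m N N (\<lambda>k j.
     complex_of_real (- \<xi> k * \<xi> j) \<cdot>\<^sub>m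
       (if \<omega> j = - \<omega> k then G (\<i> * \<omega> j) + (\<i> * \<omega> j) \<cdot>\<^sub>m mat_deriv G (\<i> * \<omega> j)
        else (1 / (- \<i> * \<omega> k - \<i> * \<omega> j)) \<cdot>\<^sub>m
          ((- \<i> * \<omega> k) \<cdot>\<^sub>m G (- \<i> * \<omega> k) - (\<i> * \<omega> j) \<cdot>\<^sub>m G (\<i> * \<omega> j))))"

definition hermite_B ::
    "nat \<Rightarrow> nat \<Rightarrow> nat \<Rightarrow> (complex \<Rightarrow> complex mat) \<Rightarrow> (nat \<Rightarrow> real) \<Rightarrow> (nat \<Rightarrow> real) \<Rightarrow> complex mat" where
  "hermite_B p m N G \<omega> \<xi> =
     block_matrix p m N 1 (\<lambda>k _. complex_of_real (\<xi> k) \<cdot>\<^sub>m G (- \<i> * \<omega> k))"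

definition hermite_C ::
    "nat \<Rightarrow> nat \<Rightarrow> nat \<Rightarrow> (complex \<Rightarrow> complex mat) \<Rightarrow> (nat \<Rightarrow> real) \<Rightarrow> (nat \<Rightarrow> real) \<Rightarrow> complex mat" where
  "hermite_C p m N G \<omega> \<xi> =
     block_matrix p m 1 N (\<lambda>_ j. complex_of_real (\<xi> j) \<cdot>\<^sub>m G (\<i> * \<omega> j))"


section \<open>Singular value decomposition and the reduced-order model\<close>

definition append_cols :: "'a :: zero mat \<Rightarrow> 'a mat \<Rightarrow> 'a mat" where
  "append_cols A B = four_block_mat A B (0\<^sub>m 0 (dim_col A)) (0\<^sub>m 0 (dim_col B))"

definition is_svd :: "complex mat \<Rightarrow> complex mat \<Rightarrow> real mat \<Rightarrow> complex mat \<Rightarrow> bool" where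
  "is_svd M U S V \<longleftrightarrow>
     U \<in> carrier_mat (dim_row M) (dim_row M) \<and>
     S \<in> carrier_mat (dim_row M) (dim_col M) \<and>
     V \<in> carrier_mat (dim_col M) (dim_col M) \<and>
     mat_adjoint U * U = 1\<^sub>m (dim_row M) \<and>
     mat_adjoint V * V = 1\<^sub>m (dim_col M) \<and>
     diagonal_mat S \<and>
     (\<forall>i < min (dim_row M) (dim_col M). 0 \<le> S $$ (i, i)) \<and>
     M = U * map_mat complex_of_real S * mat_adjoint V"

text \<open>
  An SVD split after \<open>r\<close> columns, with the \<open>r\<close> largest singular values in \<open>S1\<close>. The singular
  values need not be sorted within \<open>S1\<close> and \<open>S2\<close>; sorted decompositions are a special case.
\<close>

definition partitioned_svd ::
    "complex mat \<Rightarrow> nat \<Rightarrow> complex mat \<Rightarrow> complex mat \<Rightarrow> real mat \<Rightarrow> real mat \<Rightarrow>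
     complex mat \<Rightarrow> complex mat \<Rightarrow> bool" where
  "partitioned_svd M r U1 U2 S1 S2 V1 V2 \<longleftrightarrow>
     r \<le> min (dim_row M) (dim_col M) \<and>
     U1 \<in> carrier_mat (dim_row M) r \<and> U2 \<in> carrier_mat (dim_row M) (dim_row M - r) \<and>
     S1 \<in> carrier_mat r r \<and> S2 \<in> carrier_mat (dim_row M - r) (dim_col M - r) \<and>
     V1 \<in> carrier_mat (dim_col M) r \<and> V2 \<in> carrier_mat (dim_col M) (dim_col M - r) \<and>
     is_svd M (append_cols U1 U2)
       (four_block_mat S1 (0\<^sub>m r (dim_col M - r)) (0\<^sub>m (dim_row M - r) r) S2)
       (append_cols V1 V2) \<and>
     (\<forall>i < r. \<forall>j < min (dim_row M - r) (dim_col M - r). S2 $$ (j, j) \<le> S1 $$ (i, i))"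

text \<open>\<open>S\<^sup>-\<^sup>1\<^sup>/\<^sup>2\<close> for a diagonal matrix with positive diagonal entries.\<close>

definition diag_inv_sqrt :: "real mat \<Rightarrow> complex mat" where
  "diag_inv_sqrt S = mat (dim_row S) (dim_col S)
     (\<lambda>(i, j). if i = j then complex_of_real (1 / sqrt (S $$ (i, i))) else 0)"

definition reduced_A :: "complex mat \<Rightarrow> complex mat \<Rightarrow> real mat \<Rightarrow> complex mat \<Rightarrow> complex mat" where
  "reduced_A AL U1 S1 V1 = diag_inv_sqrt S1 * mat_adjoint U1 * AL * V1 * diag_inv_sqrt S1"

definition reduced_B :: "complex mat \<Rightarrow> complex mat \<Rightarrow> real mat \<Rightarrow> complex mat" where
  "reduced_B BL U1 S1 = diag_inv_sqrt S1 * mat_adjoint U1 * BL"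

definition reduced_C :: "complex mat \<Rightarrow> real mat \<Rightarrow> complex mat \<Rightarrow> complex mat" where
  "reduced_C CL S1 V1 = CL * V1 * diag_inv_sqrt S1"

end

theory Submission
  imports Defs
begin

text \<open>
  Under the transformation the resolvent becomes \<open>K s = (s E\<^sub>t - A\<^sub>t)\<^sup>-\<^sup>1\<close> with \<open>(K s)\<^sup>H = K (cnj s)\<close>,
  where \<open>E\<^sub>t > 0 > A\<^sub>t\<close>. The resolvent identity turns the divided differences (or derivatives) of
  \<open>G s\<close> and \<open>s G s\<close> into \<open>- C\<^sub>t (K t) E\<^sub>t (K s) C\<^sub>t\<^sup>H\<close> and \<open>- C\<^sub>t (K t) A\<^sub>t (K s) C\<^sub>t\<^sup>H\<close>. Hence the data matrices are
  \<open>R\<^sup>H E\<^sub>t R\<close>, \<open>R\<^sup>H A\<^sub>t R\<close>, \<open>R\<^sup>H C\<^sub>t\<^sup>H\<close> and \<open>C\<^sub>t R\<close>, where \<open>R\<close> has the blocks \<open>\<xi>\<^sub>j K(\<i> \<omega>\<^sub>j) C\<^sub>t\<^sup>H\<close>.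
  In an SVD of the positive semi-definite matrix \<open>R\<^sup>H E\<^sub>t R\<close>, left and right singular vectors
  for positive singular values agree. So the reduction is again a congruence, by
  \<open>R X\<close> with \<open>X = U\<^sub>1 \<Sigma>\<^sub>1\<^sup>-\<^sup>1\<^sup>/\<^sup>2\<close>; and \<open>R X\<close> is injective since \<open>(R X)\<^sup>H E\<^sub>t (R X) = I\<close>.
\<close>

section \<open>Congruences\<close>

lemma dim_mat_adjoint [simp]:
  "dim_row (mat_adjoint M) = dim_col M" "dim_col (mat_adjoint M) = dim_row M"
  by (simp_all add: mat_adjoint_def)

lemma index_mat_adjoint [simp]:
  "i < dim_col M \<Longrightarrow> j < dim_row M \<Longrightarrow> mat_adjoint M $$ (i, j) = conjugate (M $$ (j, i))"
  by (simp add: mat_adjoint_def mat_of_rows_def)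

lemma mat_adjoint_carrier [simp]:
  "M \<in> carrier_mat a b \<Longrightarrow> mat_adjoint M \<in> carrier_mat b a"
  by (metis carrier_matD carrier_matI dim_mat_adjoint)

lemma mat_adjoint_adjoint [simp]: "mat_adjoint (mat_adjoint M) = M"
  by (rule eq_matI) auto

lemma mat_adjoint_mult:
  assumes "P \<in> carrier_mat a b" and "Q \<in> carrier_mat b c"
  shows "mat_adjoint (P * Q) = mat_adjoint Q * mat_adjoint P"
  using assms
  by (intro eq_matI) (auto simp: scalar_prod_def sum_conjugate conjugate_dist_mul intro!: sum.cong)

lemma mat_adjoint_minus:
  fixes P Q :: "complex mat"
  assumes "P \<in> carrier_mat a b" and "Q \<in> carrier_mat a b"
  shows "mat_adjoint (P - Q) = mat_adjoint P - mat_adjoint Q"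
  using assms by (intro eq_matI) auto

lemma mat_adjoint_smult:
  fixes P :: "complex mat"
  shows "mat_adjoint (c \<cdot>\<^sub>m P) = cnj c \<cdot>\<^sub>m mat_adjoint P"
  by (intro eq_matI) auto

lemma cscalar_prod_mat_adjoint:
  assumes M: "M \<in> carrier_mat a b" and v: "v \<in> carrier_vec a" and w: "w \<in> carrier_vec b"
  shows "(mat_adjoint M *\<^sub>v v) \<bullet>c w = v \<bullet>c (M *\<^sub>v w)"
proof -
  have "(mat_adjoint M *\<^sub>v v) \<bullet>c w
      = (\<Sum>i<b. \<Sum>j<a. conjugate (M $$ (j, i)) * v $ j * conjugate (w $ i))"
    using assms by (auto simp: scalar_prod_def sum_distrib_right lessThan_atLeast0 intro!: sum.cong)
  also have "\<dots> = (\<Sum>j<a. \<Sum>i<b. conjugate (M $$ (j, i)) * v $ j * conjugate (w $ i))"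
    by (rule sum.swap)
  also have "\<dots> = v \<bullet>c (M *\<^sub>v w)"
    using assms by (auto simp: scalar_prod_def sum_distrib_left lessThan_atLeast0 sum_conjugate
        conjugate_dist_mul ac_simps intro!: sum.cong)
  finally show ?thesis .
qed

lemma mat_adjoint_congruence:
  assumes M: "M \<in> carrier_mat n n" and R: "R \<in> carrier_mat n q"
  shows "mat_adjoint (mat_adjoint R * M * R) = mat_adjoint R * mat_adjoint M * R"
proof -
  have "mat_adjoint (mat_adjoint R * M * R) = mat_adjoint R * (mat_adjoint M * R)"
    using mat_adjoint_mult[OF mult_carrier_mat[OF mat_adjoint_carrier[OF R] M] R]
      mat_adjoint_mult[OF mat_adjoint_carrier[OF R] M] by simp
  also have "\<dots> = mat_adjoint R * mat_adjoint M * R"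
    using M R by (intro assoc_mult_mat[symmetric]) auto
  finally show ?thesis .
qed

text \<open>The form of a congruence is the form of \<open>M\<close> pulled back along
  \<open>R\<close>; the definiteness statements below reduce to this.\<close>

lemma cscalar_prod_congruence:
  assumes M: "M \<in> carrier_mat n n" and R: "R \<in> carrier_mat n q"
    and v: "v \<in> carrier_vec q" and w: "w \<in> carrier_vec q"
  shows "((mat_adjoint R * M * R) *\<^sub>v v) \<bullet>c w = (M *\<^sub>v (R *\<^sub>v v)) \<bullet>c (R *\<^sub>v w)"
proof -
  have Rv: "R *\<^sub>v v \<in> carrier_vec n" and R': "mat_adjoint R \<in> carrier_mat q n"
    using R v by simp_all
  have "(mat_adjoint R * M * R) *\<^sub>v v = mat_adjoint R *\<^sub>v (M *\<^sub>v (R *\<^sub>v v))"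
    using assoc_mult_mat_vec[OF mult_carrier_mat[OF R' M] R v] assoc_mult_mat_vec[OF R' M Rv]
    by simp
  then show ?thesis
    using cscalar_prod_mat_adjoint[OF R _ w, of "M *\<^sub>v (R *\<^sub>v v)"] M Rv by simp
qed

text \<open>Only the weak inequality survives, because \<open>R\<close> may send a nonzero vector to
  zero, where the form vanishes.\<close>

lemma pos_semidef_congruence:
  assumes "pos_def_mat M" and "M \<in> carrier_mat n n" and "R \<in> carrier_mat n q"
  shows "pos_semidef_mat (mat_adjoint R * M * R)"
proof -
  have "0 \<le> (M *\<^sub>v x) \<bullet>c x" if "x \<in> carrier_vec n" for x
    using assms(1,2) that by (cases "x = 0\<^sub>v n") (auto simp: pos_def_mat_def)
  then show ?thesis
    using assms by (auto simp: pos_semidef_mat_def hermitian_mat_def pos_def_mat_def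
        mat_adjoint_congruence cscalar_prod_congruence)
qed

lemma neg_semidef_congruence:
  assumes "neg_def_mat M" and "M \<in> carrier_mat n n" and "R \<in> carrier_mat n q"
  shows "neg_semidef_mat (mat_adjoint R * M * R)"
proof -
  have "(M *\<^sub>v x) \<bullet>c x \<le> 0" if "x \<in> carrier_vec n" for x
    using assms(1,2) that by (cases "x = 0\<^sub>v n") (auto simp: neg_def_mat_def)
  then show ?thesis
    using assms by (auto simp: neg_semidef_mat_def hermitian_mat_def neg_def_mat_def
        mat_adjoint_congruence cscalar_prod_congruence)
qed

text \<open>A trivial kernel keeps \<open>R *\<^sub>v v\<close> nonzero, so the strict inequality
  carries over.\<close>

lemma neg_def_congruence:
  assumes "neg_def_mat M" and "M \<in> carrier_mat n n" and "R \<in> carrier_mat n q"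
    and inj: "\<And>v. v \<in> carrier_vec q \<Longrightarrow> R *\<^sub>v v = 0\<^sub>v n \<Longrightarrow> v = 0\<^sub>v q"
  shows "neg_def_mat (mat_adjoint R * M * R)"
proof -
  have "(M *\<^sub>v (R *\<^sub>v v)) \<bullet>c (R *\<^sub>v v) < 0" if "v \<in> carrier_vec q" "v \<noteq> 0\<^sub>v q" for v
  proof -
    have "R *\<^sub>v v \<in> carrier_vec n" and "R *\<^sub>v v \<noteq> 0\<^sub>v n"
      using assms(3) inj that by auto
    then show ?thesis using assms(1,2) by (simp add: neg_def_mat_def)
  qed
  then show ?thesis
    using assms(1-3) by (simp add: neg_def_mat_def hermitian_mat_def
        mat_adjoint_congruence cscalar_prod_congruence)
qed

text \<open>Lets the reduced matrices be read as congruences of a definite \<open>M\<close> rather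
  than of a data matrix \<open>mat_adjoint R * M * R\<close>, which is only semi-definite.\<close>

lemma congruence_comp:
  assumes M: "M \<in> carrier_mat n n" and R: "R \<in> carrier_mat n q" and X: "X \<in> carrier_mat q r"
  shows "mat_adjoint X * (mat_adjoint R * M * R) * X = mat_adjoint (R * X) * M * (R * X)"
proof -
  have adj: "mat_adjoint X \<in> carrier_mat r q" "mat_adjoint R \<in> carrier_mat q n"
    using R X by simp_all
  have RM: "mat_adjoint R * M \<in> carrier_mat q n" using adj M by simp
  have XR: "mat_adjoint X * mat_adjoint R \<in> carrier_mat r n" using adj by simp
  have "mat_adjoint X * (mat_adjoint R * M * R) = mat_adjoint X * mat_adjoint R * M * R"
    by (simp only: assoc_mult_mat[OF adj(1) RM R, symmetric] assoc_mult_mat[OF adj M, symmetric])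
  then show ?thesis
    by (simp only: mat_adjoint_mult[OF R X] assoc_mult_mat[OF mult_carrier_mat[OF XR M] R X])
qed

section \<open>Block rows and their congruences\<close>

text \<open>\<open>R\<close> is the block row of the \<open>X j\<close>. Its column \<open>b\<close>
  is column \<open>b mod m\<close> of \<open>X (b div m)\<close>, so entry \<open>(a, b)\<close> of
  the congruence sees only the blocks \<open>a div m\<close> and \<open>b div m\<close>.\<close>

lemma block_matrix_congruence:
  assumes M: "M \<in> carrier_mat n n" and X: "\<And>j. j < N \<Longrightarrow> X j \<in> carrier_mat n m"
  defines "R \<equiv> block_matrix n m 1 N (\<lambda>_. X)"
  shows "block_matrix m m N N (\<lambda>k j. mat_adjoint (X k) * M * X j) = mat_adjoint R * M * R"
proof (rule eq_matI)
  show "dim_row (block_matrix m m N N (\<lambda>k j. mat_adjoint (X k) * M * X j))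
      = dim_row (mat_adjoint R * M * R)"
    and "dim_col (block_matrix m m N N (\<lambda>k j. mat_adjoint (X k) * M * X j))
      = dim_col (mat_adjoint R * M * R)"
    by (simp_all add: R_def block_matrix_def)
  fix a b assume "a < dim_row (mat_adjoint R * M * R)" and "b < dim_col (mat_adjoint R * M * R)"
  then have ab: "a < m * N" "b < m * N" by (simp_all add: R_def block_matrix_def)
  \<comment> \<open>An index below \<open>m * N\<close> exists, so \<open>m\<close> is positive and
    division by \<open>m\<close> gives a valid block number.\<close>
  then have m: "0 < m" by (cases m) auto
  have div: "a div m < N" "b div m < N"
    using ab m by (simp_all add: less_mult_imp_div_less mult.commute)
  have R: "R \<in> carrier_mat n (m * N)" by (simp add: R_def block_matrix_def)
  have R_index: "R $$ (i, c) = X (c div m) $$ (i, c mod m)" if "i < n" "c < m * N" for i c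
    using that m by (simp add: R_def block_matrix_def)
  note dims = carrier_matD[OF X[OF div(1)]] carrier_matD[OF X[OF div(2)]]
  show "block_matrix m m N N (\<lambda>k j. mat_adjoint (X k) * M * X j) $$ (a, b)
      = (mat_adjoint R * M * R) $$ (a, b)"
    using ab div m M R dims
    by (auto simp: block_matrix_def scalar_prod_def R_index intro!: sum.cong)
qed

lemma block_matrix_mult_left:
  assumes C: "C \<in> carrier_mat p n" and X: "\<And>j. j < N \<Longrightarrow> X j \<in> carrier_mat n m"
  shows "C * block_matrix n m 1 N (\<lambda>_. X) = block_matrix p m 1 N (\<lambda>_ j. C * X j)"
proof (rule eq_matI)
  fix a b assume "a < dim_row (block_matrix p m 1 N (\<lambda>_ j. C * X j))"
    and "b < dim_col (block_matrix p m 1 N (\<lambda>_ j. C * X j))"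
  then have ab: "a < p" "b < m * N" by (simp_all add: block_matrix_def)
  then have m: "0 < m" by (cases m) auto
  have div: "b div m < N"
    using ab m by (simp_all add: less_mult_imp_div_less mult.commute)
  note dims = carrier_matD[OF X[OF div]]
  show "(C * block_matrix n m 1 N (\<lambda>_. X)) $$ (a, b) = block_matrix p m 1 N (\<lambda>_ j. C * X j) $$ (a, b)"
    using ab div m C dims
    by (auto simp: block_matrix_def scalar_prod_def intro!: sum.cong)
qed (use C in \<open>simp_all add: block_matrix_def\<close>)

lemma mat_adjoint_block_row:
  fixes X :: "nat \<Rightarrow> complex mat"
  assumes X: "\<And>j. j < N \<Longrightarrow> X j \<in> carrier_mat p m"
  shows "mat_adjoint (block_matrix p m 1 N (\<lambda>_. X)) = block_matrix m p N 1 (\<lambda>k _. mat_adjoint (X k))"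
proof (rule eq_matI)
  fix a b assume "a < dim_row (block_matrix m p N 1 (\<lambda>k _. mat_adjoint (X k)))"
    and "b < dim_col (block_matrix m p N 1 (\<lambda>k _. mat_adjoint (X k)))"
  then have ab: "a < m * N" "b < p" by (simp_all add: block_matrix_def)
  then have m: "0 < m" by (cases m) auto
  have div: "a div m < N"
    using ab m by (simp_all add: less_mult_imp_div_less mult.commute)
  note dims = carrier_matD[OF X[OF div]]
  show "mat_adjoint (block_matrix p m 1 N (\<lambda>_. X)) $$ (a, b)
      = block_matrix m p N 1 (\<lambda>k _. mat_adjoint (X k)) $$ (a, b)"
    using ab div m dims by (auto simp: block_matrix_def)
qed (simp_all add: block_matrix_def)

text \<open>Restricting to indices in range matters because the resolvent identities are available
  only at nodes with index below \<open>N\<close>.\<close>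

lemma block_matrix_cong:
  assumes "\<And>k j. k < K \<Longrightarrow> j < J \<Longrightarrow> F k j = F' k j"
  shows "block_matrix p m K J F = block_matrix p m K J F'"
proof (rule eq_matI)
  fix a b assume "a < dim_row (block_matrix p m K J F')" and "b < dim_col (block_matrix p m K J F')"
  then have "a < p * K" "b < m * J" by (simp_all add: block_matrix_def)
  moreover from this have "0 < p" "0 < m" by (auto intro: Nat.gr0I)
  ultimately show "block_matrix p m K J F $$ (a, b) = block_matrix p m K J F' $$ (a, b)"
    using assms by (simp add: block_matrix_def less_mult_imp_div_less mult.commute)
qed (simp_all add: block_matrix_def)

section \<open>Inverse matrices and continuity\<close>

text \<open>\<open>invertible_mat\<close> provides some two-sided inverse; membership in the units
  of the matrix ring then rules out \<open>None\<close> as the result of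
  \<open>mat_inverse\<close>.\<close>

lemma invertible_mat_inverse:
  fixes M :: "'a :: field mat"
  assumes M: "M \<in> carrier_mat n n" and inv: "invertible_mat M"
  shows "the (mat_inverse M) \<in> carrier_mat n n"
    and "M * the (mat_inverse M) = 1\<^sub>m n" and "the (mat_inverse M) * M = 1\<^sub>m n"
proof -
  obtain P where P: "M * P = 1\<^sub>m n" "P * M = 1\<^sub>m (dim_row P)"
    using inv M by (auto simp: invertible_mat_def inverts_mat_def)
  \<comment> \<open>The shape of \<open>P\<close> has to be read off from the dimensions of the two
    products.\<close>
  have "dim_row P = n" "dim_col P = n"
    using arg_cong[OF P(1), of dim_col] arg_cong[OF P(2), of dim_col] M by auto
  then have "P \<in> carrier_mat n n" by blast
  then have "M \<in> Units (ring_mat TYPE('a) n ())"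
    using P M by (auto simp: Units_def ring_mat_simps)
  then obtain Q where Q: "mat_inverse M = Some Q"
    using mat_inverse(1)[OF M] by fastforce
  show "the (mat_inverse M) \<in> carrier_mat n n"
    and "M * the (mat_inverse M) = 1\<^sub>m n" and "the (mat_inverse M) * M = 1\<^sub>m n"
    using mat_inverse(2)[OF M Q] by (simp_all add: Q)
qed

lemma left_inverse_unique_mat:
  fixes M :: "'a :: comm_ring_1 mat"
  assumes "M \<in> carrier_mat n n" and "P \<in> carrier_mat n n" and "Q \<in> carrier_mat n n"
    and "P * M = 1\<^sub>m n" and "M * Q = 1\<^sub>m n"
  shows "P = Q"
proof -
  have "P = P * (M * Q)" using assms(2,5) by simp
  also have "\<dots> = Q" using assms(3,4) assoc_mult_mat[OF assms(2,1,3)] by simp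
  finally show ?thesis .
qed

lemma invertible_mat_det:
  fixes M :: "'a :: field mat"
  assumes "M \<in> carrier_mat n n"
  shows "invertible_mat M \<longleftrightarrow> det M \<noteq> 0"
proof
  assume "invertible_mat M"
  then show "det M \<noteq> 0"
    using det_mult[OF assms invertible_mat_inverse(1)[OF assms]]
      invertible_mat_inverse(2)[OF assms] by (metis det_one mult_zero_left zero_neq_one)
next
  assume "det M \<noteq> 0"
  from det_non_zero_imp_unit[OF assms this] obtain P
    where "P \<in> carrier_mat n n" "P * M = 1\<^sub>m n" "M * P = 1\<^sub>m n"
    by (auto simp: Units_def ring_mat_simps)
  then show "invertible_mat M"
    using assms by (auto simp: invertible_mat_def inverts_mat_def)
qed

section \<open>Continuity of determinant and inverse\<close>

text \<open>By the Leibniz formula the determinant is a polynomial in the entries.\<close>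

lemma isCont_det:
  fixes M :: "complex \<Rightarrow> complex mat"
  assumes M: "\<And>z. M z \<in> carrier_mat n n"
    and cont: "\<And>i j. i < n \<Longrightarrow> j < n \<Longrightarrow> isCont (\<lambda>z. M z $$ (i, j)) s"
  shows "isCont (\<lambda>z. det (M z)) s"
proof -
  have "isCont (\<lambda>z. M z $$ (i, q i)) s" if "q permutes {0..<n}" "i \<in> {0..<n}" for q i
    using cont[of i "q i"] that permutes_in_image[OF that(1), of i] by simp
  then have "isCont (\<lambda>z. \<Sum>q | q permutes {0..<n}. signof q * (\<Prod>i = 0..<n. M z $$ (i, q i))) s"
    by (intro isCont_sum isCont_mult continuous_const continuous_prod ballI) simp_all
  then show ?thesis
    by (simp add: det_def'[OF M])
qed

text \<open>Cramer's rule: it expresses the entries of the inverse through determinants, which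
  depend continuously on the entries.\<close>

lemma mat_inverse_adj_mat:
  fixes M :: "'a :: field mat"
  assumes M: "M \<in> carrier_mat n n" and inv: "invertible_mat M"
  shows "the (mat_inverse M) = inverse (det M) \<cdot>\<^sub>m adj_mat M"
proof (rule left_inverse_unique_mat[OF M])
  have "det M \<noteq> 0" using inv by (simp add: invertible_mat_det[OF M])
  then show "M * (inverse (det M) \<cdot>\<^sub>m adj_mat M) = 1\<^sub>m n"
    unfolding mult_smult_distrib[OF M adj_mat(1)[OF M]] adj_mat(2)[OF M]
    by (intro eq_matI) simp_all
  show "inverse (det M) \<cdot>\<^sub>m adj_mat M \<in> carrier_mat n n"
    using adj_mat(1)[OF M] by simp
qed (fact invertible_mat_inverse[OF M inv])+

text \<open>A nonzero determinant stays nonzero nearby, and there Cramer's rule writes each entry as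
  a quotient of continuous functions. Farther away \<open>the (mat_inverse (M z))\<close> may be
  unspecified, so the formula is claimed only eventually.\<close>

lemma isCont_mat_inverse:
  fixes M :: "complex \<Rightarrow> complex mat"
  assumes M: "\<And>z. M z \<in> carrier_mat n n"
    and cont: "\<And>i j. i < n \<Longrightarrow> j < n \<Longrightarrow> isCont (\<lambda>z. M z $$ (i, j)) s"
    and inv: "invertible_mat (M s)"
  shows "\<forall>\<^sub>F z in nhds s. invertible_mat (M z)"
    and "i < n \<Longrightarrow> j < n \<Longrightarrow> isCont (\<lambda>z. the (mat_inverse (M z)) $$ (i, j)) s"
proof -
  have det: "isCont (\<lambda>z. det (M z)) s" "det (M s) \<noteq> 0"
    using isCont_det[OF M cont] inv by (simp_all add: invertible_mat_det[OF M])
  then have "\<forall>\<^sub>F z in at s. det (M z) \<noteq> 0"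
    using tendsto_imp_eventually_ne[of "\<lambda>z. det (M z)"] by (simp add: isCont_def)
  then show ev: "\<forall>\<^sub>F z in nhds s. invertible_mat (M z)"
    using inv by (simp add: eventually_nhds_conv_at invertible_mat_det[OF M])
  assume ij: "i < n" "j < n"
  \<comment> \<open>The adjugate transposes the cofactors: entry \<open>(i, j)\<close> uses the
    minor without row \<open>j\<close> and column \<open>i\<close>.\<close>
  have delete: "isCont (\<lambda>z. det (mat_delete (M z) j i)) s"
  proof (rule isCont_det)
    show "mat_delete (M z) j i \<in> carrier_mat (n - 1) (n - 1)" for z
      using M by (metis mat_delete_carrier)
    show "isCont (\<lambda>z. mat_delete (M z) j i $$ (i', j')) s" if "i' < n - 1" "j' < n - 1" for i' j'
      using that M[THEN carrier_matD(1)] M[THEN carrier_matD(2)] cont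
      by (simp add: mat_delete_def)
  qed
  have "isCont (\<lambda>z. inverse (det (M z)) * ((-1) ^ (j + i) * det (mat_delete (M z) j i))) s"
    by (intro continuous_intros det delete)
  moreover have "\<forall>\<^sub>F z in nhds s. inverse (det (M z)) * ((-1) ^ (j + i) * det (mat_delete (M z) j i))
      = the (mat_inverse (M z)) $$ (i, j)"
    using ev
  proof eventually_elim
    case (elim z)
    then show ?case
      using ij carrier_matD[OF M[of z]]
      by (simp add: mat_inverse_adj_mat[OF M] adj_mat_def cofactor_def)
  qed
  ultimately show "isCont (\<lambda>z. the (mat_inverse (M z)) $$ (i, j)) s"
    by (simp add: isCont_cong)
qed

text \<open>A nonzero kernel vector would make the form vanish. Applied to the transformed
  \<open>E\<close>, this yields the invertibility of \<open>T\<close> and \<open>W\<close> in the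
  theorem.\<close>

lemma pos_def_mat_invertible:
  assumes pos: "pos_def_mat M" and M: "M \<in> carrier_mat n n"
  shows "invertible_mat M"
proof (rule ccontr)
  assume "\<not> invertible_mat M"
  then obtain v where v: "v \<in> carrier_vec n" "v \<noteq> 0\<^sub>v n" "M *\<^sub>v v = 0\<^sub>v n"
    using det_0_iff_vec_prod_zero[OF M] by (auto simp: invertible_mat_det[OF M])
  then have "0 < (M *\<^sub>v v) \<bullet>c v" using pos M by (auto simp: pos_def_mat_def)
  then show False using v by simp
qed

section \<open>Resolvents and transfer functions\<close>

definition resolvent :: "complex mat \<Rightarrow> complex mat \<Rightarrow> complex \<Rightarrow> complex mat" where
  "resolvent E A s = the (mat_inverse (s \<cdot>\<^sub>m E - A))"

lemma transfer_function_resolvent: "transfer_function E A B C s = C * resolvent E A s * B"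
  by (simp add: transfer_function_def resolvent_def)

lemma resolvent:
  assumes E: "E \<in> carrier_mat n n" and A: "A \<in> carrier_mat n n"
    and inv: "invertible_mat (s \<cdot>\<^sub>m E - A)"
  shows "resolvent E A s \<in> carrier_mat n n"
    and "(s \<cdot>\<^sub>m E - A) * resolvent E A s = 1\<^sub>m n"
    and "resolvent E A s * (s \<cdot>\<^sub>m E - A) = 1\<^sub>m n"
  using invertible_mat_inverse[OF _ inv, of n] A minus_carrier_mat[OF A]
  by (auto simp: resolvent_def)

text \<open>
  Sandwiching \<open>s E - A\<close> and \<open>t E - A\<close> between the resolvents at \<open>t\<close> and \<open>s\<close> gives two linear
  equations for the bilinear expressions in \<open>E\<close> and \<open>A\<close>; solving them yields the
  (divided difference) entries of the Hermite data matrices.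
\<close>

lemma transfer_function_bilinear:
  assumes E: "E \<in> carrier_mat n n" and A: "A \<in> carrier_mat n n"
    and B: "B \<in> carrier_mat n m" and C: "C \<in> carrier_mat p n"
    and t: "invertible_mat (t \<cdot>\<^sub>m E - A)" and s: "invertible_mat (s \<cdot>\<^sub>m E - A)"
  defines "P \<equiv> C * resolvent E A t" and "Q \<equiv> resolvent E A s * B"
  shows "transfer_function E A B C t = s \<cdot>\<^sub>m (P * E * Q) - P * A * Q"
    and "transfer_function E A B C s = t \<cdot>\<^sub>m (P * E * Q) - P * A * Q"
proof -
  note Kt = resolvent[OF E A t] and Ks = resolvent[OF E A s]
  have P: "P \<in> carrier_mat p n" and Q: "Q \<in> carrier_mat n m"
    using B C Kt(1) Ks(1) by (auto simp: P_def Q_def)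
  have pencil: "z \<cdot>\<^sub>m E - A \<in> carrier_mat n n" for z
    using A by (rule minus_carrier_mat)
  have expand: "P * (z \<cdot>\<^sub>m E - A) * Q = z \<cdot>\<^sub>m (P * E * Q) - P * A * Q" for z
  proof -
    have "P * (z \<cdot>\<^sub>m E - A) = z \<cdot>\<^sub>m (P * E) - P * A"
      using mult_minus_distrib_mat[OF P smult_carrier_mat[OF E] A, of z]
        mult_smult_distrib[OF P E, of z] by simp
    also have "\<dots> * Q = z \<cdot>\<^sub>m (P * E) * Q - P * A * Q"
      using minus_mult_distrib_mat[OF _ mult_carrier_mat[OF P A] Q, of "z \<cdot>\<^sub>m (P * E)"] P E by simp
    also have "z \<cdot>\<^sub>m (P * E) * Q = z \<cdot>\<^sub>m (P * E * Q)"
      using mult_smult_assoc_mat[OF mult_carrier_mat[OF P E] Q] by simp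
    finally show ?thesis .
  qed
  \<comment> \<open>The parameters cross over: the pencil at \<open>s\<close> cancels the resolvent
    inside \<open>Q\<close> and leaves the transfer function at \<open>t\<close>; below, the pencil
    at \<open>t\<close> cancels the one inside \<open>P\<close> and leaves the value at
    \<open>s\<close>.\<close>
  have "(s \<cdot>\<^sub>m E - A) * Q = B"
    using assoc_mult_mat[OF pencil Ks(1) B, symmetric] Ks(2) B by (simp add: Q_def)
  then have "P * (s \<cdot>\<^sub>m E - A) * Q = P * B"
    using assoc_mult_mat[OF P pencil Q] by simp
  then show "transfer_function E A B C t = s \<cdot>\<^sub>m (P * E * Q) - P * A * Q"
    unfolding expand by (simp add: transfer_function_resolvent P_def)
  have "P * (t \<cdot>\<^sub>m E - A) = C"
    using assoc_mult_mat[OF C Kt(1) pencil] Kt(3) C by (simp add: P_def)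
  then have "P * (t \<cdot>\<^sub>m E - A) * Q = C * resolvent E A s * B"
    using assoc_mult_mat[OF C Ks(1) B] by (simp add: Q_def)
  then show "transfer_function E A B C s = t \<cdot>\<^sub>m (P * E * Q) - P * A * Q"
    unfolding expand by (simp add: transfer_function_resolvent)
qed

lemma isCont_resolvent:
  assumes E: "E \<in> carrier_mat n n" and A: "A \<in> carrier_mat n n"
    and inv: "invertible_mat (s \<cdot>\<^sub>m E - A)"
  shows "\<forall>\<^sub>F z in nhds s. invertible_mat (z \<cdot>\<^sub>m E - A)"
    and "i < n \<Longrightarrow> j < n \<Longrightarrow> isCont (\<lambda>z. resolvent E A z $$ (i, j)) s"
proof -
  have carrier: "z \<cdot>\<^sub>m E - A \<in> carrier_mat n n" for z
    using A by (rule minus_carrier_mat)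
  have cont: "isCont (\<lambda>z. (z \<cdot>\<^sub>m E - A) $$ (i, j)) s" if "i < n" "j < n" for i j
    using that E A by simp
  note * = isCont_mat_inverse[OF carrier cont inv]
  show "\<forall>\<^sub>F z in nhds s. invertible_mat (z \<cdot>\<^sub>m E - A)"
    by (rule *(1))
  show "i < n \<Longrightarrow> j < n \<Longrightarrow> isCont (\<lambda>z. resolvent E A z $$ (i, j)) s"
    unfolding resolvent_def by (rule *(2))
qed

text \<open>By the bilinear identities the difference quotient between \<open>z\<close> and
  \<open>s\<close> is exactly \<open>- (C * resolvent E A z * E * (resolvent E A s * B))\<close>;
  continuity of the resolvent gives its limit as \<open>z\<close> tends to \<open>s\<close>.\<close>

lemma mat_deriv_transfer_function:
  assumes E: "E \<in> carrier_mat n n" and A: "A \<in> carrier_mat n n"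
    and B: "B \<in> carrier_mat n m" and C: "C \<in> carrier_mat p n"
    and s: "invertible_mat (s \<cdot>\<^sub>m E - A)"
  shows "mat_deriv (transfer_function E A B C) s
      = - (C * resolvent E A s * E * (resolvent E A s * B))"
proof (rule eq_matI)
  let ?G = "transfer_function E A B C" and ?K = "resolvent E A"
  define X where "X = E * (?K s * B)"
  have X: "X \<in> carrier_mat n m"
    using resolvent(1)[OF E A s] E B by (simp add: X_def)
  fix i j
  assume "i < dim_row (- (C * ?K s * E * (?K s * B)))" and "j < dim_col (- (C * ?K s * E * (?K s * B)))"
  then have i: "i < p" and j: "j < m" using B C by simp_all
  define h where "h z = (\<Sum>l<n. (\<Sum>k<n. C $$ (i, k) * ?K z $$ (k, l)) * X $$ (l, j))" for z
  have h: "(C * ?K z * E * (?K s * B)) $$ (i, j) = h z" if "invertible_mat (z \<cdot>\<^sub>m E - A)" for z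
  proof -
    have K: "?K z \<in> carrier_mat n n" by (rule resolvent(1)[OF E A that])
    have "C * ?K z * E * (?K s * B) = C * ?K z * X"
      unfolding X_def
      by (rule assoc_mult_mat[OF mult_carrier_mat[OF C K] E
            mult_carrier_mat[OF resolvent(1)[OF E A s] B]])
    moreover have "(C * ?K z * X) $$ (i, j) = h z"
      using C K X i j by (auto simp: h_def scalar_prod_def lessThan_atLeast0
          simp del: assoc_mult_mat intro!: sum.cong)
    ultimately show ?thesis by simp
  qed
  have "isCont h s"
    unfolding h_def using isCont_resolvent(2)[OF E A s]
    by (intro isCont_sum isCont_mult continuous_const ballI) simp_all
  then have lim: "((\<lambda>z. - h z) \<longlongrightarrow> - h s) (at s)"
    by (intro tendsto_minus) (simp add: isCont_def)
  have "((\<lambda>z. ?G z $$ (i, j)) has_field_derivative - h s) (at s)"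
    unfolding has_field_derivative_iff
  proof (rule Lim_transform_eventually[OF lim])
    have "\<forall>\<^sub>F z in at s. invertible_mat (z \<cdot>\<^sub>m E - A) \<and> z \<noteq> s"
      using isCont_resolvent(1)[OF E A s] by (simp add: eventually_nhds_conv_at eventually_conj_iff eventually_neq_at_within)
    then show "\<forall>\<^sub>F z in at s. - h z = (?G z $$ (i, j) - ?G s $$ (i, j)) / (z - s)"
    proof eventually_elim
      case (elim z)
      note G = transfer_function_bilinear[OF E A B C conjunct1[OF elim] s]
      have dims: "C * ?K z * E * (?K s * B) \<in> carrier_mat p m"
        "C * ?K z * A * (?K s * B) \<in> carrier_mat p m"
        using E A B C resolvent(1)[OF E A s] resolvent(1)[OF E A conjunct1[OF elim]]
        by (auto intro!: mult_carrier_mat)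
      \<comment> \<open>Subtracting the two bilinear identities cancels the term with
        \<open>A\<close> and leaves \<open>s - z\<close> times the term with
        \<open>E\<close>.\<close>
      have "?G z $$ (i, j) - ?G s $$ (i, j) = (s - z) * h z"
        using dims i j unfolding G h[OF conjunct1[OF elim], symmetric]
        by (simp add: algebra_simps del: index_mult_mat)
      then show ?case using elim by (simp add: field_simps)
    qed
  qed
  then have "deriv (\<lambda>z. ?G z $$ (i, j)) s = - h s" by (rule DERIV_imp_deriv)
  then show "mat_deriv ?G s $$ (i, j) = (- (C * ?K s * E * (?K s * B))) $$ (i, j)"
    using i j B C h[OF s] by (simp add: mat_deriv_def transfer_function_def)
qed (use B C in \<open>simp_all add: mat_deriv_def transfer_function_def\<close>)

section \<open>Invariance under state-space transformations\<close>

text \<open>The pencil of the transformed pair is \<open>W * (s \<cdot>\<^sub>m E - A) * T\<close>.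
  Its inverse carries the inverse of \<open>T\<close> on the left and that of \<open>W\<close> on
  the right, which the outer factors cancel. The theorem uses this with the adjoint of its own
  \<open>W\<close>.\<close>

lemma resolvent_transform:
  assumes E: "E \<in> carrier_mat n n" and A: "A \<in> carrier_mat n n"
    and T: "T \<in> carrier_mat n n" and W: "W \<in> carrier_mat n n"
    and inv_T: "invertible_mat T" and inv_W: "invertible_mat W"
    and inv: "invertible_mat (s \<cdot>\<^sub>m E - A)"
  shows "invertible_mat (s \<cdot>\<^sub>m (W * E * T) - W * A * T)"
    and "resolvent E A s = T * resolvent (W * E * T) (W * A * T) s * W"
proof -
  let ?E = "W * E * T" and ?A = "W * A * T" and ?L = "s \<cdot>\<^sub>m E - A"
  have E': "?E \<in> carrier_mat n n" and A': "?A \<in> carrier_mat n n"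
    using E A T W by simp_all
  have L: "?L \<in> carrier_mat n n" using A by (rule minus_carrier_mat)
  have WE: "W * E \<in> carrier_mat n n" and WA: "W * A \<in> carrier_mat n n"
    using E A W by simp_all
  have "W * ?L = s \<cdot>\<^sub>m (W * E) - W * A"
    using mult_minus_distrib_mat[OF W smult_carrier_mat[OF E] A] mult_smult_distrib[OF W E] by simp
  then have pencil: "W * ?L * T = s \<cdot>\<^sub>m ?E - ?A"
    using minus_mult_distrib_mat[OF smult_carrier_mat[OF WE] WA T] mult_smult_assoc_mat[OF WE T] by simp
  have "det (W * ?L * T) = det W * det ?L * det T"
    using det_mult[OF mult_carrier_mat[OF W L] T] det_mult[OF W L] by simp
  then show inv': "invertible_mat (s \<cdot>\<^sub>m ?E - ?A)"
    using inv inv_T inv_W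
    by (simp add: pencil[symmetric] invertible_mat_det[OF L] invertible_mat_det[OF T]
        invertible_mat_det[OF W] invertible_mat_det[OF mult_carrier_mat[OF mult_carrier_mat[OF W L] T]])
  note K = resolvent[OF E' A' inv'] and Wi = invertible_mat_inverse[OF W inv_W]
  let ?K = "resolvent ?E ?A s" and ?Wi = "the (mat_inverse W)"
  show "resolvent E A s = T * ?K * W"
  proof (rule left_inverse_unique_mat[OF L])
    have TK: "T * ?K \<in> carrier_mat n n" and KW: "?K * W \<in> carrier_mat n n"
      and TKW: "T * ?K * W \<in> carrier_mat n n"
      using T K(1) W by simp_all
    have WL: "W * ?L \<in> carrier_mat n n" using W L by simp
    \<comment> \<open>\<open>W\<close> is put in front to complete the transformed pencil; its
      inverse removes it again afterwards.\<close>
    have "W * (?L * (T * ?K * W)) = W * ?L * T * ?K * W"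
      by (simp only: assoc_mult_mat[OF W L TKW, symmetric] assoc_mult_mat[OF WL TK W, symmetric]
          assoc_mult_mat[OF WL T K(1), symmetric])
    also have "\<dots> = W" using K(2) W by (simp only: pencil left_mult_one_mat)
    finally have "?Wi * (W * (?L * (T * ?K * W))) = 1\<^sub>m n" using Wi(3) by simp
    then show "?L * (T * ?K * W) = 1\<^sub>m n"
      using assoc_mult_mat[OF Wi(1) W mult_carrier_mat[OF L TKW], symmetric] Wi(3)
        left_mult_one_mat[OF mult_carrier_mat[OF L TKW]] by simp
    show "T * ?K * W \<in> carrier_mat n n" by (rule TKW)
  qed (use resolvent[OF E A inv] in simp_all)
qed

lemma transfer_function_transform:
  assumes E: "E \<in> carrier_mat n n" and A: "A \<in> carrier_mat n n"
    and B: "B \<in> carrier_mat n m" and C: "C \<in> carrier_mat p n"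
    and T: "T \<in> carrier_mat n n" and W: "W \<in> carrier_mat n n"
    and inv_T: "invertible_mat T" and inv_W: "invertible_mat W"
    and inv: "invertible_mat (s \<cdot>\<^sub>m E - A)"
  shows "transfer_function (W * E * T) (W * A * T) (W * B) (C * T) s = transfer_function E A B C s"
proof -
  note transform = resolvent_transform[OF E A T W inv_T inv_W inv]
  let ?K = "resolvent (W * E * T) (W * A * T) s"
  have K: "?K \<in> carrier_mat n n"
    using E A T W by (intro resolvent(1)[OF _ _ transform(1)]) simp_all
  have TK: "T * ?K \<in> carrier_mat n n" using T K by simp
  have "C * (T * ?K * W) * B = C * T * ?K * W * B"
    by (simp only: assoc_mult_mat[OF C TK W, symmetric] assoc_mult_mat[OF C T K, symmetric])
  also have "\<dots> = C * T * ?K * (W * B)"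
    by (rule assoc_mult_mat[OF mult_carrier_mat[OF mult_carrier_mat[OF C T] K] W B])
  finally show ?thesis
    by (simp only: transfer_function_resolvent transform(2))
qed

text \<open>The derivative depends only on values near \<open>s\<close>. It serves to compare two
  transfer functions whose agreement is known only where the pencil is invertible.\<close>

lemma mat_deriv_cong:
  assumes eq: "\<forall>\<^sub>F z in nhds s. G z = H z"
  shows "mat_deriv G s = mat_deriv H s"
proof -
  have "G s = H s" using eq by (rule eventually_nhds_x_imp_x)
  moreover have "deriv (\<lambda>z. G z $$ (i, j)) s = deriv (\<lambda>z. H z $$ (i, j)) s" for i j
    using eq by (intro deriv_cong_ev) (auto elim: eventually_mono)
  ultimately show ?thesis by (simp add: mat_deriv_def)
qed

section \<open>Hermite data matrices as congruences\<close>

text \<open>With \<open>X = P * E * Q\<close> and \<open>Y = P * A * Q\<close> the bilinear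
  identities read \<open>G t = s X - Y\<close> and \<open>G s = t X - Y\<close>. Hence
  \<open>G t - G s = (s - t) X\<close> and \<open>t G t - s G s = (s - t) Y\<close>; for
  \<open>t = s\<close> the derivative is \<open>- X\<close>, which turns \<open>G s + s G'\<close>
  into \<open>- Y\<close>. These are the blocks of the Loewner and shifted Loewner matrices.\<close>

lemma loewner_blocks:
  assumes E: "E \<in> carrier_mat n n" and A: "A \<in> carrier_mat n n"
    and B: "B \<in> carrier_mat n m" and C: "C \<in> carrier_mat p n"
    and t: "invertible_mat (t \<cdot>\<^sub>m E - A)" and s: "invertible_mat (s \<cdot>\<^sub>m E - A)"
  defines "P \<equiv> C * resolvent E A t" and "Q \<equiv> resolvent E A s * B" and "G \<equiv> transfer_function E A B C"
  shows "(if t = s then mat_deriv G s else (1 / (t - s)) \<cdot>\<^sub>m (G t - G s)) = - (P * E * Q)"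
    and "(if t = s then G s + s \<cdot>\<^sub>m mat_deriv G s
          else (1 / (t - s)) \<cdot>\<^sub>m (t \<cdot>\<^sub>m G t - s \<cdot>\<^sub>m G s)) = - (P * A * Q)"
proof -
  note bilinear = transfer_function_bilinear[OF E A B C t s, folded P_def Q_def G_def]
  have P: "P \<in> carrier_mat p n" and Q: "Q \<in> carrier_mat n m"
    using B C resolvent(1)[OF E A t] resolvent(1)[OF E A s] by (auto simp: P_def Q_def)
  have deriv: "mat_deriv G s = - (P * E * Q)" if "t = s"
    using mat_deriv_transfer_function[OF E A B C s] that by (simp add: P_def Q_def G_def)
  obtain PE PA where PE: "P * E * Q = PE" "PE \<in> carrier_mat p m"
    and PA: "P * A * Q = PA" "PA \<in> carrier_mat p m"
    using P Q E A by (meson mult_carrier_mat)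
  show "(if t = s then mat_deriv G s else (1 / (t - s)) \<cdot>\<^sub>m (G t - G s)) = - (P * E * Q)"
    using PE(2) PA(2) unfolding bilinear PE(1) PA(1)
    by (intro eq_matI) (auto simp: deriv PE(1) divide_simps; simp add: algebra_simps)+
  show "(if t = s then G s + s \<cdot>\<^sub>m mat_deriv G s
          else (1 / (t - s)) \<cdot>\<^sub>m (t \<cdot>\<^sub>m G t - s \<cdot>\<^sub>m G s)) = - (P * A * Q)"
    using PE(2) PA(2) unfolding bilinear PE(1) PA(1)
    by (intro eq_matI) (auto simp: deriv PE(1) divide_simps; simp add: algebra_simps)+
qed

text \<open>Since \<open>E\<close> and \<open>A\<close> are Hermitian, the adjoint of the pencil at
  \<open>s\<close> is the pencil at \<open>cnj s\<close>; uniqueness of inverses does the rest. On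
  the imaginary axis \<open>cnj s = - s\<close>, which pairs right nodes with left nodes.\<close>

lemma resolvent_adjoint:
  assumes E: "E \<in> carrier_mat n n" and A: "A \<in> carrier_mat n n"
    and "hermitian_mat E" and "hermitian_mat A"
    and s: "invertible_mat (s \<cdot>\<^sub>m E - A)" and t: "invertible_mat (cnj s \<cdot>\<^sub>m E - A)"
  shows "mat_adjoint (resolvent E A s) = resolvent E A (cnj s)"
proof (rule left_inverse_unique_mat[where M = "cnj s \<cdot>\<^sub>m E - A"])
  note K = resolvent[OF E A s]
  have pencil: "s \<cdot>\<^sub>m E - A \<in> carrier_mat n n"
    using A by (rule minus_carrier_mat)
  have "mat_adjoint (resolvent E A s) * mat_adjoint (s \<cdot>\<^sub>m E - A) = mat_adjoint (1\<^sub>m n)"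
    using mat_adjoint_mult[OF pencil K(1)] K(2) by simp
  moreover have "mat_adjoint (s \<cdot>\<^sub>m E - A) = cnj s \<cdot>\<^sub>m E - A"
    using assms(3,4) mat_adjoint_minus[OF smult_carrier_mat[OF E] A, of s]
    by (simp add: mat_adjoint_smult hermitian_mat_def)
  moreover have "mat_adjoint (1\<^sub>m n) = (1\<^sub>m n :: complex mat)"
    by (intro eq_matI) auto
  ultimately show "mat_adjoint (resolvent E A s) * (cnj s \<cdot>\<^sub>m E - A) = 1\<^sub>m n" by simp
  show "(cnj s \<cdot>\<^sub>m E - A) * resolvent E A (cnj s) = 1\<^sub>m n"
    by (rule resolvent(2)[OF E A t])
  show "resolvent E A (cnj s) \<in> carrier_mat n n"
    by (rule resolvent(1)[OF E A t])
qed (use A minus_carrier_mat[OF A] resolvent(1)[OF E A s] in auto)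

text \<open>Left nodes are conjugates of right nodes and the input matrix is
  \<open>mat_adjoint C\<close>, so the left factor \<open>P k\<close> of a Loewner block is the
  adjoint of the right factor \<open>Q k\<close>.\<close>

lemma hermite_matrices_congruence:
  fixes \<omega> \<xi> :: "nat \<Rightarrow> real"
  assumes E: "E \<in> carrier_mat n n" and A: "A \<in> carrier_mat n n" and C: "C \<in> carrier_mat m n"
    and herm: "hermitian_mat E" "hermitian_mat A"
    and inv: "\<forall>i < N. invertible_mat ((\<i> * \<omega> i) \<cdot>\<^sub>m E - A) \<and> invertible_mat ((- \<i> * \<omega> i) \<cdot>\<^sub>m E - A)"
  defines "G \<equiv> transfer_function E A (mat_adjoint C) C"
  defines "R \<equiv> block_matrix n m 1 N
    (\<lambda>_ j. complex_of_real (\<xi> j) \<cdot>\<^sub>m (resolvent E A (\<i> * \<omega> j) * mat_adjoint C))"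
  shows "hermite_E m m N G \<omega> \<xi> = mat_adjoint R * E * R"
    and "hermite_A m m N G \<omega> \<xi> = mat_adjoint R * A * R"
    and "hermite_C m m N G \<omega> \<xi> = C * R"
    and "hermite_B m m N G \<omega> \<xi> = mat_adjoint (C * R)"
proof -
  let ?K = "resolvent E A"
  define P where "P k = C * ?K (- \<i> * \<omega> k)" for k
  define Q where "Q j = ?K (\<i> * \<omega> j) * mat_adjoint C" for j
  define X where "X j = complex_of_real (\<xi> j) \<cdot>\<^sub>m Q j" for j
  have R: "R = block_matrix n m 1 N (\<lambda>_. X)"
    unfolding R_def by (intro block_matrix_cong) (simp add: X_def Q_def)
  have B: "mat_adjoint C \<in> carrier_mat n m" using C by simp
  have K: "?K (\<i> * \<omega> j) \<in> carrier_mat n n" "?K (- \<i> * \<omega> j) \<in> carrier_mat n n" if "j < N" for j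
    using inv that by (auto intro!: resolvent(1)[OF E A])
  have Q: "Q j \<in> carrier_mat n m" and P: "P j \<in> carrier_mat m n" and X: "X j \<in> carrier_mat n m"
    if "j < N" for j
    using K[OF that] C by (auto simp: P_def Q_def X_def)
  have K_adj: "mat_adjoint (?K (\<i> * \<omega> k)) = ?K (- \<i> * \<omega> k)" if "k < N" for k
    using resolvent_adjoint[OF E A herm, of "\<i> * \<omega> k"] inv that by simp
  have Q_adj: "mat_adjoint (Q k) = P k" if "k < N" for k
    using mat_adjoint_mult[OF K(1)[OF that] B] K_adj[OF that] by (simp add: P_def Q_def)
  \<comment> \<open>The minus sign of the weight cancels the one in the Loewner block. The factors
    \<open>\<xi> k\<close> and \<open>\<xi> j\<close> go to the left and the right copy; being real,
    \<open>\<xi> k\<close> is unchanged by the adjoint.\<close>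
  have block: "complex_of_real (- \<xi> k * \<xi> j) \<cdot>\<^sub>m - (P k * M * Q j) = mat_adjoint (X k) * M * X j"
    if "M \<in> carrier_mat n n" "k < N" "j < N" for M k j
  proof -
    note PM = mult_carrier_mat[OF P[OF that(2)] that(1)]
    have "mat_adjoint (X k) = complex_of_real (\<xi> k) \<cdot>\<^sub>m P k"
      by (simp add: X_def mat_adjoint_smult Q_adj that)
    then have "mat_adjoint (X k) * M * X j
        = complex_of_real (\<xi> k) \<cdot>\<^sub>m (complex_of_real (\<xi> j) \<cdot>\<^sub>m (P k * M * Q j))"
      using mult_smult_assoc_mat[OF P[OF that(2)] that(1)]
        mult_smult_assoc_mat[OF PM smult_carrier_mat[OF Q[OF that(3)]]]
        mult_smult_distrib[OF PM Q[OF that(3)]]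
      by (simp add: X_def)
    then show ?thesis
      using P[OF that(2)] Q[OF that(3)] by (intro eq_matI) (auto simp del: index_mult_mat(1))
  qed
  \<comment> \<open>Turns the case condition on frequencies into equality of the interpolation
    points, the form used in \<open>loewner_blocks\<close>.\<close>
  have node_eq: "\<omega> j = - \<omega> k \<longleftrightarrow> - \<i> * complex_of_real (\<omega> k) = \<i> * complex_of_real (\<omega> j)" for j k
    by (auto simp: complex_eq_iff)
  note loewner = loewner_blocks[OF E A B C, folded G_def]
  have "hermite_E m m N G \<omega> \<xi> = block_matrix m m N N (\<lambda>k j. mat_adjoint (X k) * E * X j)"
    unfolding hermite_E_def node_eq
  proof (rule block_matrix_cong)
    fix k j assume kj: "k < N" "j < N"
    then have "invertible_mat ((- \<i> * \<omega> k) \<cdot>\<^sub>m E - A)" "invertible_mat ((\<i> * \<omega> j) \<cdot>\<^sub>m E - A)"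
      using inv by auto
    note loewner(1)[OF this, folded P_def Q_def]
    then show "complex_of_real (- \<xi> k * \<xi> j) \<cdot>\<^sub>m
      (if - \<i> * complex_of_real (\<omega> k) = \<i> * complex_of_real (\<omega> j) then mat_deriv G (\<i> * \<omega> j)
       else (1 / (- \<i> * \<omega> k - \<i> * \<omega> j)) \<cdot>\<^sub>m (G (- \<i> * \<omega> k) - G (\<i> * \<omega> j)))
      = mat_adjoint (X k) * E * X j"
      using block[OF E kj] by (simp only:)
  qed
  then show "hermite_E m m N G \<omega> \<xi> = mat_adjoint R * E * R"
    using block_matrix_congruence[OF E X] by (simp add: R)
  have "hermite_A m m N G \<omega> \<xi> = block_matrix m m N N (\<lambda>k j. mat_adjoint (X k) * A * X j)"
    unfolding hermite_A_def node_eq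
  proof (rule block_matrix_cong)
    fix k j assume kj: "k < N" "j < N"
    then have "invertible_mat ((- \<i> * \<omega> k) \<cdot>\<^sub>m E - A)" "invertible_mat ((\<i> * \<omega> j) \<cdot>\<^sub>m E - A)"
      using inv by auto
    note loewner(2)[OF this, folded P_def Q_def]
    then show "complex_of_real (- \<xi> k * \<xi> j) \<cdot>\<^sub>m
      (if - \<i> * complex_of_real (\<omega> k) = \<i> * complex_of_real (\<omega> j)
       then G (\<i> * \<omega> j) + (\<i> * \<omega> j) \<cdot>\<^sub>m mat_deriv G (\<i> * \<omega> j)
       else (1 / (- \<i> * \<omega> k - \<i> * \<omega> j)) \<cdot>\<^sub>m
         ((- \<i> * \<omega> k) \<cdot>\<^sub>m G (- \<i> * \<omega> k) - (\<i> * \<omega> j) \<cdot>\<^sub>m G (\<i> * \<omega> j)))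
      = mat_adjoint (X k) * A * X j"
      using block[OF A kj] by (simp only:)
  qed
  then show "hermite_A m m N G \<omega> \<xi> = mat_adjoint R * A * R"
    using block_matrix_congruence[OF A X] by (simp add: R)
  have CX: "complex_of_real (\<xi> j) \<cdot>\<^sub>m G (\<i> * \<omega> j) = C * X j" if "j < N" for j
    using mult_smult_distrib[OF C Q[OF that]] assoc_mult_mat[OF C K(1)[OF that] B]
    by (simp add: G_def transfer_function_resolvent X_def Q_def)
  have CR: "C * R = block_matrix m m 1 N (\<lambda>_ j. C * X j)"
    unfolding R by (rule block_matrix_mult_left) (fact C X)+
  show "hermite_C m m N G \<omega> \<xi> = C * R"
    unfolding hermite_C_def CR by (intro block_matrix_cong CX)
  have G_adj: "mat_adjoint (G (\<i> * \<omega> k)) = G (- \<i> * \<omega> k)" if "k < N" for k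
  proof -
    have "G (\<i> * \<omega> k) = C * Q k" 
      using assoc_mult_mat[OF C K(1)[OF that] B]
      by (simp add: G_def transfer_function_resolvent Q_def)
    then show ?thesis
      using mat_adjoint_mult[OF C Q[OF that]] Q_adj[OF that]
      by (simp add: G_def transfer_function_resolvent P_def)
  qed
  have "mat_adjoint (C * R) = block_matrix m m N 1 (\<lambda>k _. mat_adjoint (C * X k))"
    unfolding CR
    using C X by (intro mat_adjoint_block_row mult_carrier_mat) auto
  also have "\<dots> = hermite_B m m N G \<omega> \<xi>"
    unfolding hermite_B_def
    by (intro block_matrix_cong) (simp add: CX[symmetric] mat_adjoint_smult G_adj)
  finally show "hermite_B m m N G \<omega> \<xi> = mat_adjoint (C * R)" by simp
qed

text \<open>The data matrices sample \<open>G\<close> and its derivative only at the nodes, so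
  \<open>G\<close> may be exchanged for a function that agrees with it there.\<close>

lemma hermite_cong:
  fixes \<omega> \<xi> :: "nat \<Rightarrow> real"
  assumes G: "\<And>i. i < N \<Longrightarrow> G (\<i> * \<omega> i) = H (\<i> * \<omega> i)" "\<And>i. i < N \<Longrightarrow> G (- \<i> * \<omega> i) = H (- \<i> * \<omega> i)"
    and G': "\<And>i. i < N \<Longrightarrow> mat_deriv G (\<i> * \<omega> i) = mat_deriv H (\<i> * \<omega> i)"
  shows "hermite_E p m N G \<omega> \<xi> = hermite_E p m N H \<omega> \<xi>"
    and "hermite_A p m N G \<omega> \<xi> = hermite_A p m N H \<omega> \<xi>"
    and "hermite_B p m N G \<omega> \<xi> = hermite_B p m N H \<omega> \<xi>"
    and "hermite_C p m N G \<omega> \<xi> = hermite_C p m N H \<omega> \<xi>"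
  unfolding hermite_E_def hermite_A_def hermite_B_def hermite_C_def
  by (intro block_matrix_cong; simp only: G G')+

section \<open>Singular value decompositions and the reduced model\<close>

lemma mult_diagonal_index:
  assumes "U \<in> carrier_mat a q" and "S \<in> carrier_mat q q" and "diagonal_mat S"
    and "i < a" and "j < q"
  shows "(U * map_mat complex_of_real S) $$ (i, j) = U $$ (i, j) * complex_of_real (S $$ (j, j))"
proof -
  have "(U * map_mat complex_of_real S) $$ (i, j)
      = (\<Sum>k<q. U $$ (i, k) * complex_of_real (S $$ (k, j)))"
    using assms by (auto simp: scalar_prod_def lessThan_atLeast0)
  also have "\<dots> = (\<Sum>k<q. if k = j then U $$ (i, j) * complex_of_real (S $$ (j, j)) else 0)"
    using assms by (intro sum.cong) (auto simp: diagonal_mat_def)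
  finally show ?thesis using assms by simp
qed

text \<open>\<open>S\<close> is real and diagonal, so taking adjoints in \<open>M = U S V^H\<close>
  also gives \<open>M = V S U^H\<close>. Up to the singular value, \<open>M\<close> therefore swaps
  each pair of left and right singular vectors.\<close>

lemma svd_hermitian:
  assumes herm: "hermitian_mat M" and M: "M \<in> carrier_mat q q" and svd: "is_svd M U S V"
  shows "M * V = U * map_mat complex_of_real S" and "M * U = V * map_mat complex_of_real S"
proof -
  let ?S = "map_mat complex_of_real S"
  have U: "U \<in> carrier_mat q q" and V: "V \<in> carrier_mat q q" and S: "?S \<in> carrier_mat q q"
    and diag: "diagonal_mat S"
    and UU: "mat_adjoint U * U = 1\<^sub>m q" and VV: "mat_adjoint V * V = 1\<^sub>m q"
    and M_eq: "M = U * ?S * mat_adjoint V"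
    using svd M by (auto simp: is_svd_def)
  have US: "U * ?S \<in> carrier_mat q q" using U S by simp
  have VS: "V * ?S \<in> carrier_mat q q" using V S by simp
  have adj_U: "mat_adjoint U \<in> carrier_mat q q" and adj_V: "mat_adjoint V \<in> carrier_mat q q"
    using U V by simp_all
  have "mat_adjoint ?S = ?S"
    using S diag by (intro eq_matI) (auto simp: diagonal_mat_def, metis)
  then have "mat_adjoint M = V * (?S * mat_adjoint U)"
    unfolding M_eq mat_adjoint_mult[OF US adj_V] mat_adjoint_mult[OF U S] by simp
  then have M_eq': "M = V * ?S * mat_adjoint U"
    using herm assoc_mult_mat[OF V S adj_U] by (simp add: hermitian_mat_def)
  show "M * V = U * ?S"
    by (subst M_eq) (use assoc_mult_mat[OF US adj_V V] VV right_mult_one_mat[OF US] in simp)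
  show "M * U = V * ?S"
    by (subst M_eq') (use assoc_mult_mat[OF VS adj_U U] UU right_mult_one_mat[OF VS] in simp)
qed

text \<open>The difference \<open>u - v\<close> would be an eigenvector for the eigenvalue \<open>- \<sigma>\<close>.\<close>

lemma pos_semidef_swap_imp_eq:
  assumes psd: "pos_semidef_mat M" and M: "M \<in> carrier_mat q q"
    and u: "u \<in> carrier_vec q" and v: "v \<in> carrier_vec q" and \<sigma>: "0 < \<sigma>"
    and Mv: "M *\<^sub>v v = complex_of_real \<sigma> \<cdot>\<^sub>v u" and Mu: "M *\<^sub>v u = complex_of_real \<sigma> \<cdot>\<^sub>v v"
  shows "u = v"
proof -
  define w where "w = u - v"
  have w: "w \<in> carrier_vec q" using u v by (simp add: w_def)
  have "M *\<^sub>v w = complex_of_real (- \<sigma>) \<cdot>\<^sub>v w"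
    unfolding w_def mult_minus_distrib_mat_vec[OF M u v] Mu Mv
    using u v by (intro eq_vecI) (auto simp: algebra_simps)
  then have "(M *\<^sub>v w) \<bullet>c w = complex_of_real (- \<sigma>) * (w \<bullet>c w)"
    using w by simp
  moreover have "0 \<le> (M *\<^sub>v w) \<bullet>c w"
    using psd M w by (simp add: pos_semidef_mat_def)
  moreover have "0 \<le> w \<bullet>c w" by (rule conjugate_square_ge_0_vec)
  ultimately have "w \<bullet>c w = 0"
    using \<sigma> by (auto simp: less_eq_complex_def complex_eq_iff mult_le_0_iff zero_le_mult_iff)
  then have "w = 0\<^sub>v q" using w by simp
  then show ?thesis
    using u v unfolding w_def by (intro eq_vecI) (auto simp: vec_eq_iff)
qed

text \<open>Invertibility of \<open>S1\<close> makes its singular values positive, so the swapping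
  relations force left and right singular vectors to coincide. The last claim then follows from
  \<open>M * U1 = U1 * S1\<close> and the orthonormal columns of \<open>U1\<close>.\<close>

lemma partitioned_svd_pos_semidef:
  assumes psd: "pos_semidef_mat M" and M: "M \<in> carrier_mat q q"
    and svd: "partitioned_svd M r U1 U2 S1 S2 V1 V2" and inv: "invertible_mat S1"
  shows "V1 = U1" and "U1 \<in> carrier_mat q r" and "S1 \<in> carrier_mat r r"
    and "diagonal_mat S1" and "\<And>i. i < r \<Longrightarrow> 0 < S1 $$ (i, i)"
    and "mat_adjoint U1 * M * U1 = map_mat complex_of_real S1"
proof -
  define U where "U = append_cols U1 U2"
  define V where "V = append_cols V1 V2"
  define S where "S = four_block_mat S1 (0\<^sub>m r (q - r)) (0\<^sub>m (q - r) r) S2"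
  have r: "r \<le> q" and U1: "U1 \<in> carrier_mat q r" and U2: "U2 \<in> carrier_mat q (q - r)"
    and V1: "V1 \<in> carrier_mat q r" and V2: "V2 \<in> carrier_mat q (q - r)"
    and S1: "S1 \<in> carrier_mat r r" and S2: "S2 \<in> carrier_mat (q - r) (q - r)"
    and is_svd: "is_svd M U S V"
    using svd M by (auto simp: partitioned_svd_def U_def V_def S_def)
  show "U1 \<in> carrier_mat q r" "S1 \<in> carrier_mat r r" by fact+
  have U: "U \<in> carrier_mat q q" and V: "V \<in> carrier_mat q q" and S: "S \<in> carrier_mat q q"
    and S_diag: "diagonal_mat S" and S_nonneg: "i < q \<Longrightarrow> 0 \<le> S $$ (i, i)"
    and UU: "mat_adjoint U * U = 1\<^sub>m q" for i
    using is_svd M by (auto simp: is_svd_def)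
  have U_index: "U $$ (a, i) = U1 $$ (a, i)" and V_index: "V $$ (a, i) = V1 $$ (a, i)"
    if "a < q" "i < r" for a i
    using that r U1 U2 V1 V2 by (simp_all add: U_def V_def append_cols_def)
  have S_index: "S $$ (i, j) = S1 $$ (i, j)" if "i < r" "j < r" for i j
    using that r S1 S2 by (simp add: S_def)
  show diag: "diagonal_mat S1"
    using S_diag S_index S S1 r by (auto simp: diagonal_mat_def) (metis order_less_le_trans)
  show pos: "0 < S1 $$ (i, i)" if i: "i < r" for i
  proof -
    note S1inv = invertible_mat_inverse[OF S1 inv]
    \<comment> \<open>A zero diagonal entry would be a zero row of the diagonal matrix
      \<open>S1\<close>, hence a zero row of its product with the inverse.\<close>
    have "S1 $$ (i, i) \<noteq> 0"
    proof
      assume "S1 $$ (i, i) = 0"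
      then have "S1 $$ (i, k) = 0" if "k < r" for k
        using that i diag S1 by (cases "k = i") (auto simp: diagonal_mat_def)
      then have "(S1 * the (mat_inverse S1)) $$ (i, i) = 0"
        using i S1 S1inv(1) by (auto simp: scalar_prod_def)
      then show False using S1inv(2) i by simp
    qed
    then show ?thesis using S_nonneg[of i] S_index[of i i] i r by simp
  qed
  \<comment> \<open>Passage to the first \<open>r\<close> columns, kept abstract because it is used
    with \<open>U\<close> and \<open>V\<close> in either order.\<close>
  have mult_index: "(M * Y) $$ (a, i) = Y' $$ (a, i) * complex_of_real (S1 $$ (i, i))"
    if "M * Z = Z' * map_mat complex_of_real S" "Z \<in> carrier_mat q q" "Z' \<in> carrier_mat q q"
      "Y \<in> carrier_mat q r" "\<And>a i. a < q \<Longrightarrow> i < r \<Longrightarrow> Z $$ (a, i) = Y $$ (a, i)"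
      "\<And>a i. a < q \<Longrightarrow> i < r \<Longrightarrow> Z' $$ (a, i) = Y' $$ (a, i)"
      "a < q" "i < r" for Y Y' Z Z' a i
  proof -
    have "(M * Y) $$ (a, i) = (M * Z) $$ (a, i)"
      using that(2,4,5,7,8) M r by (auto simp: scalar_prod_def intro!: sum.cong)
    also have "\<dots> = Z' $$ (a, i) * complex_of_real (S $$ (i, i))"
      unfolding that(1) using that(7,8) r by (intro mult_diagonal_index[OF that(3) S S_diag]) auto
    finally show ?thesis using that(6-8) S_index by simp
  qed
  have psd': "hermitian_mat M" using psd by (simp add: pos_semidef_mat_def)
  have MV: "(M * V1) $$ (a, i) = U1 $$ (a, i) * complex_of_real (S1 $$ (i, i))"
    and MU: "(M * U1) $$ (a, i) = V1 $$ (a, i) * complex_of_real (S1 $$ (i, i))"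
    if "a < q" "i < r" for a i
    using that by (auto intro: mult_index[OF svd_hermitian(1)[OF psd' M is_svd] V U V1 V_index U_index]
        mult_index[OF svd_hermitian(2)[OF psd' M is_svd] U V U1 U_index V_index])
  have col_eq: "col U1 i = col V1 i" if i: "i < r" for i
  proof (rule pos_semidef_swap_imp_eq[OF psd M])
    show "col U1 i \<in> carrier_vec q" "col V1 i \<in> carrier_vec q" using U1 V1 by (auto simp: col_def)
    show "0 < S1 $$ (i, i)" by (rule pos[OF i])
    have MV_col: "row M a \<bullet> col V1 i = U1 $$ (a, i) * complex_of_real (S1 $$ (i, i))"
      and MU_col: "row M a \<bullet> col U1 i = V1 $$ (a, i) * complex_of_real (S1 $$ (i, i))"
      if "a < q" for a
      using MV[OF that i] MU[OF that i] M U1 V1 i that by simp_all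
    show "M *\<^sub>v col V1 i = complex_of_real (S1 $$ (i, i)) \<cdot>\<^sub>v col U1 i"
      using M U1 V1 i MV_col by (intro eq_vecI) (simp_all add: mult.commute)
    show "M *\<^sub>v col U1 i = complex_of_real (S1 $$ (i, i)) \<cdot>\<^sub>v col V1 i"
      using M U1 V1 i MU_col by (intro eq_vecI) (simp_all add: mult.commute)
  qed
  show "V1 = U1"
    using U1 V1 col_eq by (intro mat_col_eqI) auto
  have MU1: "M * U1 = U1 * map_mat complex_of_real S1"
    using M U1 S1 MU \<open>V1 = U1\<close> diag
    by (intro eq_matI) (auto simp del: index_mult_mat(1) simp: mult_diagonal_index[OF U1 S1 diag])
  have UU1: "mat_adjoint U1 * U1 = 1\<^sub>m r"
  proof (rule eq_matI)
    fix i j assume "i < dim_row (1\<^sub>m r :: complex mat)" "j < dim_col (1\<^sub>m r :: complex mat)"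
    then have ij: "i < r" "j < r" by simp_all
    have "(mat_adjoint U1 * U1) $$ (i, j) = (mat_adjoint U * U) $$ (i, j)"
      using ij r U U1 U_index by (auto simp: scalar_prod_def intro!: sum.cong)
    then show "(mat_adjoint U1 * U1) $$ (i, j) = 1\<^sub>m r $$ (i, j)"
      unfolding UU using ij r by simp
  qed (use U1 in auto)
  have adj_U1: "mat_adjoint U1 \<in> carrier_mat r q" using U1 by simp
  have S1c: "map_mat complex_of_real S1 \<in> carrier_mat r r" using S1 by simp
  show "mat_adjoint U1 * M * U1 = map_mat complex_of_real S1"
    using assoc_mult_mat[OF adj_U1 M U1] assoc_mult_mat[OF adj_U1 U1 S1c] MU1 UU1
      left_mult_one_mat[OF S1c] by simp
qed

section \<open>Balancing by the inverse square root\<close>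

lemma diag_inv_sqrt:
  assumes S: "S \<in> carrier_mat r r" and diag: "diagonal_mat S"
    and pos: "\<And>i. i < r \<Longrightarrow> 0 < S $$ (i, i)"
  shows "diag_inv_sqrt S \<in> carrier_mat r r" and "mat_adjoint (diag_inv_sqrt S) = diag_inv_sqrt S"
    and "diag_inv_sqrt S * map_mat complex_of_real S * diag_inv_sqrt S = 1\<^sub>m r"
proof -
  \<comment> \<open>A real version of \<open>diag_inv_sqrt S\<close>, since
    \<open>mult_diagonal_index\<close> expects a real diagonal matrix as right factor.\<close>
  let ?T = "mat r r (\<lambda>(i, j). if i = j then 1 / sqrt (S $$ (i, i)) else 0)"
  have D: "diag_inv_sqrt S = map_mat complex_of_real ?T"
    using S by (intro eq_matI) (auto simp: diag_inv_sqrt_def)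
  show carrier: "diag_inv_sqrt S \<in> carrier_mat r r"
    using S by (simp add: diag_inv_sqrt_def)
  show "mat_adjoint (diag_inv_sqrt S) = diag_inv_sqrt S"
    using S by (intro eq_matI) (auto simp: diag_inv_sqrt_def)
  have sqrt: "complex_of_real x / (complex_of_real (sqrt x) * complex_of_real (sqrt x)) = 1"
    if "0 < x" for x
    using that by (simp flip: of_real_mult)
  have T: "?T \<in> carrier_mat r r" "diagonal_mat ?T" by (auto simp: diagonal_mat_def)
  have DS: "diag_inv_sqrt S * map_mat complex_of_real S \<in> carrier_mat r r"
    using carrier S by simp
  show "diag_inv_sqrt S * map_mat complex_of_real S * diag_inv_sqrt S = 1\<^sub>m r"
  proof (rule eq_matI)
    fix i j assume "i < dim_row (1\<^sub>m r :: complex mat)" "j < dim_col (1\<^sub>m r :: complex mat)"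
    then have ij: "i < r" "j < r" by simp_all
    show "(diag_inv_sqrt S * map_mat complex_of_real S * diag_inv_sqrt S) $$ (i, j) = 1\<^sub>m r $$ (i, j)"
      using mult_diagonal_index[OF DS T ij, folded D] mult_diagonal_index[OF carrier S diag ij]
        ij S sqrt[OF pos[OF ij(1)]]
      by (cases "i = j") (simp_all add: diag_inv_sqrt_def del: index_mult_mat(1))
  qed (use carrier in auto)
qed

lemma pos_def_one: "pos_def_mat (1\<^sub>m r)"
proof -
  have "mat_adjoint (1\<^sub>m r) = (1\<^sub>m r :: complex mat)"
    by (intro eq_matI) auto
  then show ?thesis by (simp add: pos_def_mat_def hermitian_mat_def)
qed

text \<open>With \<open>V1 = U1\<close> the reduction multiplies by a single matrix \<open>X\<close>
  and its adjoint. Semi-definiteness of \<open>mat_adjoint R * A * R\<close> would give only a weak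
  inequality; the strict one is drawn from \<open>A\<close> itself, through the congruence by
  \<open>R * X\<close>.\<close>

lemma hermitian_dissipative_reduced:
  assumes dissipative: "hermitian_dissipative E A (mat_adjoint C) C"
    and E: "E \<in> carrier_mat n n" and A: "A \<in> carrier_mat n n" and C: "C \<in> carrier_mat m n"
    and R: "R \<in> carrier_mat n q"
    and svd: "partitioned_svd (mat_adjoint R * E * R) r U1 U2 S1 S2 V1 V2"
    and inv: "invertible_mat S1"
  shows "hermitian_dissipative (1\<^sub>m r)
    (reduced_A (mat_adjoint R * A * R) U1 S1 V1)
    (reduced_B (mat_adjoint (C * R)) U1 S1) (reduced_C (C * R) S1 V1)"
proof -
  have E_pos: "pos_def_mat E" and A_neg: "neg_def_mat A"
    using dissipative by (simp_all add: hermitian_dissipative_def)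
  let ?M = "mat_adjoint R * E * R"
  have adj_R: "mat_adjoint R \<in> carrier_mat q n" using R by simp
  have M: "?M \<in> carrier_mat q q" and AL: "mat_adjoint R * A * R \<in> carrier_mat q q"
    by (rule mult_carrier_mat[OF mult_carrier_mat[OF adj_R] R], fact)+
  note svd' = partitioned_svd_pos_semidef[OF pos_semidef_congruence[OF E_pos E R] M svd inv]
  define D where "D = diag_inv_sqrt S1"
  note D = diag_inv_sqrt[OF svd'(3,4,5), folded D_def]
  define X where "X = U1 * D"
  note U1 = svd'(2)
  have X: "X \<in> carrier_mat q r" using U1 D(1) by (simp add: X_def)
  have X_adj: "mat_adjoint X = D * mat_adjoint U1"
    by (simp only: X_def mat_adjoint_mult[OF U1 D(1)] D(2))
  have RX: "R * X \<in> carrier_mat n r" using R X by simp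
  have adj_U1: "mat_adjoint U1 \<in> carrier_mat r q" using U1 by simp
  have DU: "D * mat_adjoint U1 \<in> carrier_mat r q" using D(1) adj_U1 by simp
  \<comment> \<open>Matches the bracketing of \<open>reduced_A\<close> with a congruence by
    \<open>X\<close>; applied to both data matrices.\<close>
  have sandwich: "mat_adjoint X * F * X = D * mat_adjoint U1 * F * U1 * D"
    if F: "F \<in> carrier_mat q q" for F
    unfolding X_adj unfolding X_def
    by (rule assoc_mult_mat[OF mult_carrier_mat[OF DU F] U1 D(1), symmetric])
  have "mat_adjoint X * ?M * X = D * (mat_adjoint U1 * ?M * U1) * D"
    unfolding sandwich[OF M]
    by (simp only: assoc_mult_mat[OF D(1) adj_U1 M] assoc_mult_mat[OF D(1) mult_carrier_mat[OF adj_U1 M] U1])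
  then have one: "mat_adjoint (R * X) * E * (R * X) = 1\<^sub>m r"
    by (simp only: congruence_comp[OF E R X, symmetric] svd'(6) D(3))
  have "neg_def_mat (mat_adjoint (R * X) * A * (R * X))"
  proof (rule neg_def_congruence[OF A_neg A RX])
    fix v assume v: "v \<in> carrier_vec r" and "R * X *\<^sub>v v = 0\<^sub>v n"
    \<comment> \<open>By \<open>one\<close>, \<open>v \<bullet>c v\<close> is the form of
      \<open>E\<close> at \<open>R * X *\<^sub>v v\<close>, which is zero here.\<close>
    then have "v \<bullet>c v = (E *\<^sub>v 0\<^sub>v n) \<bullet>c 0\<^sub>v n"
      using cscalar_prod_congruence[OF E RX v v] one by simp
    also have "\<dots> = 0" using E by simp
    finally show "v = 0\<^sub>v r" using v by simp
  qed
  then have "neg_def_mat (reduced_A (mat_adjoint R * A * R) U1 S1 V1)"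
    by (simp only: reduced_A_def svd'(1) D_def[symmetric] sandwich[OF AL, symmetric]
        congruence_comp[OF A R X])
  moreover have "reduced_B (mat_adjoint (C * R)) U1 S1 = mat_adjoint (reduced_C (C * R) S1 V1)"
  proof -
    have CR: "C * R \<in> carrier_mat m q" using C R by simp
    have "reduced_C (C * R) S1 V1 = C * R * X"
      unfolding reduced_C_def svd'(1) D_def[symmetric] X_def by (rule assoc_mult_mat[OF CR U1 D(1)])
    then show ?thesis
      by (simp only: mat_adjoint_mult[OF CR X] X_adj reduced_B_def D_def[symmetric])
  qed
  ultimately show ?thesis
    by (simp add: hermitian_dissipative_def pos_def_one)
qed

section \<open>Passage to the Hermitian dissipative realization\<close>

theorem theorem2:
  fixes E A B C T W :: "complex mat" and G :: "complex \<Rightarrow> complex mat"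
    and n m p N :: nat and \<omega> \<xi> :: "nat \<Rightarrow> real"
  assumes "E \<in> carrier_mat n n" and "A \<in> carrier_mat n n"
    and "B \<in> carrier_mat n m" and "C \<in> carrier_mat p n"
    and "G = transfer_function E A B C"
    and "T \<in> carrier_mat n n" and "W \<in> carrier_mat n n"
    and "hermitian_dissipative
           (mat_adjoint W * E * T) (mat_adjoint W * A * T) (mat_adjoint W * B) (C * T)"
    and "N \<ge> 1"
    and "\<forall>i < N. invertible_mat ((\<i> * \<omega> i) \<cdot>\<^sub>m E - A) \<and> invertible_mat ((- \<i> * \<omega> i) \<cdot>\<^sub>m E - A)"
  shows "let EL = hermite_E p m N G \<omega> \<xi>; AL = hermite_A p m N G \<omega> \<xi>;
             BL = hermite_B p m N G \<omega> \<xi>; CL = hermite_C p m N G \<omega> \<xi> in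
         pos_semidef_mat EL \<and> neg_semidef_mat AL \<and> BL = mat_adjoint CL \<and>
         (\<forall>r U1 U2 S1 S2 V1 V2.
            partitioned_svd EL r U1 U2 S1 S2 V1 V2 \<longrightarrow> invertible_mat S1 \<longrightarrow>
            hermitian_dissipative
              (1\<^sub>m r) (reduced_A AL U1 S1 V1) (reduced_B BL U1 S1) (reduced_C CL S1 V1))"
proof -
  note E = assms(1) and A = assms(2) and B = assms(3) and C = assms(4)
    and T = assms(6) and W = mat_adjoint_carrier[OF assms(7)]
  define Et At Ct where "Et = mat_adjoint W * E * T" and "At = mat_adjoint W * A * T"
    and "Ct = C * T"
  note tilde_defs = Et_def At_def Ct_def
  have Et: "Et \<in> carrier_mat n n" and At: "At \<in> carrier_mat n n" and Ct: "Ct \<in> carrier_mat p n"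
    using E A C T W by (simp_all add: tilde_defs)
  have Bt: "mat_adjoint W * B = mat_adjoint Ct"
    and pos: "pos_def_mat Et" and neg: "neg_def_mat At"
    using assms(8) by (simp_all add: hermitian_dissipative_def tilde_defs)
  \<comment> \<open>\<open>B\<close> contributes \<open>m\<close> columns to the left side of
    \<open>Bt\<close>, and the adjoint of \<open>Ct\<close> has \<open>p\<close>.\<close>
  have "m = p"
    using arg_cong[OF Bt, of dim_col] B Ct by simp
  \<comment> \<open>\<open>det Et\<close> is nonzero because \<open>Et\<close> is positive definite,
    so none of its three factors vanishes.\<close>
  have "det (mat_adjoint W * E * T) = det (mat_adjoint W) * det E * det T"
    using det_mult[OF mult_carrier_mat[OF W E] T] det_mult[OF W E] by simp
  then have inv_T: "invertible_mat T" and inv_W: "invertible_mat (mat_adjoint W)"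
    using pos_def_mat_invertible[OF pos Et] invertible_mat_det[OF Et]
      invertible_mat_det[OF T] invertible_mat_det[OF W] by (auto simp: Et_def)
  define H where "H = transfer_function Et At (mat_adjoint Ct) Ct"
  have GH: "G s = H s" if "invertible_mat (s \<cdot>\<^sub>m E - A)" for s
    using transfer_function_transform[OF E A B C T W inv_T inv_W that]
    by (simp only: H_def tilde_defs Bt[unfolded Ct_def, symmetric] assms(5))
  \<comment> \<open>Invertibility of the pencil is an open condition, so \<open>G\<close> and
    \<open>H\<close> agree on a neighbourhood of \<open>s\<close>.\<close>
  have "mat_deriv G s = mat_deriv H s" if "invertible_mat (s \<cdot>\<^sub>m E - A)" for s
    using isCont_resolvent(1)[OF E A that] by (intro mat_deriv_cong) (auto elim: eventually_mono GH)
  then have hermite: "hermite_E p m N G \<omega> \<xi> = hermite_E p p N H \<omega> \<xi>"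
      "hermite_A p m N G \<omega> \<xi> = hermite_A p p N H \<omega> \<xi>"
      "hermite_B p m N G \<omega> \<xi> = hermite_B p p N H \<omega> \<xi>"
      "hermite_C p m N G \<omega> \<xi> = hermite_C p p N H \<omega> \<xi>"
    unfolding \<open>m = p\<close> using GH assms(10) by (intro hermite_cong; simp)+
  have inv_tilde: "\<forall>i < N. invertible_mat ((\<i> * \<omega> i) \<cdot>\<^sub>m Et - At) \<and> invertible_mat ((- \<i> * \<omega> i) \<cdot>\<^sub>m Et - At)"
    using resolvent_transform(1)[OF E A T W inv_T inv_W] assms(10) unfolding tilde_defs by blast
  have herm: "hermitian_mat Et" "hermitian_mat At"
    using pos neg by (simp_all add: pos_def_mat_def neg_def_mat_def)
  define R where "R = block_matrix n p 1 N
    (\<lambda>_ j. complex_of_real (\<xi> j) \<cdot>\<^sub>m (resolvent Et At (\<i> * \<omega> j) * mat_adjoint Ct))"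
  have R: "R \<in> carrier_mat n (p * N)" by (simp add: R_def block_matrix_def)
  note data = hermite_matrices_congruence[OF Et At Ct herm inv_tilde, of \<xi>, folded H_def R_def]
  have "hermitian_dissipative Et At (mat_adjoint Ct) Ct"
    using pos neg by (simp add: hermitian_dissipative_def)
  then show ?thesis
    unfolding Let_def hermite data
    using pos_semidef_congruence[OF pos Et R] neg_semidef_congruence[OF neg At R]
      hermitian_dissipative_reduced[OF _ Et At Ct R] by blast
qed

end
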